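(* Let $p$ be an odd prime and $m\ge1$. Then $$\Psi^w_{\mathbb{Z}_{p^m}}(x)=\frac{2}{p^{m-1}(p-1)}\sum_{d\mid\frac{\phi(p^m)}{2}}\phi\!\left(\frac{\phi(p^m)}{2d}\right)\left(\left(1+x^{\frac{\phi(p^m)}{d}}\right)^{d}-1\right)\prod_{k=1}^{m-1}\left(1+x^{\frac{\phi(p^{m-k})}{g_k(d)}}\right)^{g_k(d)},$$ where $g_k(d)=\gcd\!\left(d,\frac{\phi(p^{m-k})}{2}\right)$; hence $$\mathcal{E}^w(\mathbb{Z}_{p^m})=\Psi^w_{\mathbb{Z}_{p^m}}(1)=\frac{2}{p^{m-1}(p-1)}\sum_{d\mid\frac{\phi(p^m)}{2}}\phi\!\left(\frac{\phi(p^m)}{2d}\right)\left(2^d-1\right)\prod_{k=1}^{m-1}2^{g_k(d)}.$$ Here $\phi$ is Euler's totient function and an empty product equals $1$.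
   Context: For a finite group $\mathcal{A}$ with identity $e$, let $G(\mathcal{A})=\{\Omega\subseteq\mathcal{A}:\Omega^{-1}=\Omega,\ \langle\Omega\rangle=\mathcal{A},\ e\notin\Omega\}$. $\mathrm{Aut}(\mathcal{A})$ acts on $G(\mathcal{A})$ by $\alpha\cdot\Omega=\alpha(\Omega)$. For $k\ge1$ let $a^w_k(\mathcal{A})$ be the number of orbits of $\mathrm{Aut}(\mathcal{A})$ on $\{\Omega\in G(\mathcal{A}):|\Omega|=k\}$ (the number of weak equivalence classes of Cayley graphs $C(\mathcal{A},\Omega)$ of degree $k$); $\Psi^w_{\mathcal{A}}(x)=\sum_{k=1}^{|\mathcal{A}|-1}a^w_k(\mathcal{A})x^k$ and $\mathcal{E}^w(\mathcal{A})=\Psi^w_{\mathcal{A}}(1)$. For cyclic groups $\mathbb{Z}_n$, $\mathrm{Aut}(\mathbb{Z}_n)$ consists of multiplications by units mod $n$. *)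

theory Defs
  imports "HOL-Algebra.Algebra" "HOL-Number_Theory.Number_Theory"
    "HOL-Computational_Algebra.Polynomial"
begin

definition cayley_sets :: "('a, 'b) monoid_scheme \<Rightarrow> 'a set set" where
  "cayley_sets G = {\<Omega>. \<Omega> \<subseteq> carrier G \<and> (\<lambda>x. inv\<^bsub>G\<^esub> x) ` \<Omega> = \<Omega>
      \<and> generate G \<Omega> = carrier G \<and> \<one>\<^bsub>G\<^esub> \<notin> \<Omega>}"

definition aw :: "('a, 'b) monoid_scheme \<Rightarrow> nat \<Rightarrow> nat" where
  "aw G k = card ({\<Omega> \<in> cayley_sets G. card \<Omega> = k} //
      {(\<Omega>, \<Omega>'). \<Omega> \<in> cayley_sets G \<and> card \<Omega> = k \<and> \<Omega>' \<in> cayley_sets G \<and> card \<Omega>' = k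
         \<and> (\<exists>\<alpha> \<in> iso G G. \<alpha> ` \<Omega> = \<Omega>')})"

definition Psi_w :: "('a, 'b) monoid_scheme \<Rightarrow> real poly" where
  "Psi_w G = (\<Sum>k = 1..card (carrier G) - 1. monom (real (aw G k)) k)"

definition E_w :: "('a, 'b) monoid_scheme \<Rightarrow> nat" where
  "E_w G = (\<Sum>k = 1..card (carrier G) - 1. aw G k)"

definition Zn :: "nat \<Rightarrow> int monoid" where
  "Zn n = add_monoid (residue_ring (int n))"

end

theory Submission
  imports Defs
begin

text \<open>Let \<open>r\<close> be a primitive root modulo all powers of \<open>p\<close> and \<open>N = \<phi>(p^m) / 2\<close>. A symmetric subset of
  \<open>\<int>/p^m\<close> without \<open>0\<close> generates iff it contains a unit, and multiplication by \<open>r\<close> acts on such sets as a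
  permutation whose \<open>N\<close>-th power is the identity, because \<open>r^N = -1\<close>. Since all automorphisms are
  multiplications by powers of \<open>r\<close>, Burnside's lemma gives \<open>N a_k = \<Sum>\<^sub>j |Fix(r^j)|\<close> in each degree \<open>k\<close>. On the residues of
  \<open>p\<close>-adic valuation \<open>l\<close>, the group generated by \<open>r^j\<close> and \<open>-1\<close> has \<open>gcd(j, \<phi>(p^(m-l))/2)\<close> orbits
  of equal size. A set fixed by \<open>r^j\<close> is a union of such orbits, at least one of them consisting of units, so the fixed
  sets have the product generating function of the formula, which depends only on \<open>d = gcd(j, N)\<close>; and
  \<open>d\<close> arises from \<open>\<phi>(N/d)\<close> values of \<open>j\<close>.\<close>

subsection \<open>Orbit counting and generating functions\<close>

text \<open>Because \<open>f ^^ N\<close> is the identity on \<open>E\<close>, the powers of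
  \<open>f\<close> give an action of the integers modulo \<open>N\<close>, to which Burnside's lemma
  applies. The index runs over 1..N to match \<open>sum_gcd_eq_sum_divisors\<close>.\<close>

lemma burnside_funpow:
  fixes f :: "'a \<Rightarrow> 'a"
  assumes fin: "finite E" and N: "N > 0" and f: "f \<in> E \<rightarrow> E"
    and per: "\<And>x. x \<in> E \<Longrightarrow> (f ^^ N) x = x"
  shows "N * card (E // {(x, y). x \<in> E \<and> y \<in> E \<and> (\<exists>j. y = (f ^^ j) x)}) =
    (\<Sum>j\<in>{0<..N}. card {x \<in> E. (f ^^ j) x = x})"
proof -
  let ?G = "integer_mod_group N"
  let ?R = "{(x, y). x \<in> E \<and> y \<in> E \<and> (\<exists>j. y = (f ^^ j) x)}"
  \<comment> \<open>Elements of \<open>BijGroup E\<close> are extensional functions, hence the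
    restriction to \<open>E\<close>.\<close>
  define \<phi> where "\<phi> = (\<lambda>j::int. \<lambda>x\<in>E. (f ^^ nat j) x)"
  have closed: "(f ^^ j) x \<in> E" if "x \<in> E" for x j
    using that f by (induction j) auto
  have md: "(f ^^ (j mod N)) x = (f ^^ j) x" if "x \<in> E" for x j
    using per[OF that] by (rule funpow_mod_eq)
  have carr: "carrier ?G = {0..<int N}"
    using N by (simp add: carrier_integer_mod_group)
  have bij: "bij_betw (f ^^ j) E E" for j
  \<comment> \<open>The inverse of \<open>f ^^ j\<close> must be a natural power of
    \<open>f\<close>; \<open>N * j - j\<close> works because \<open>f ^^ (N * j)\<close> is the
    identity on \<open>E\<close>.\<close>
  proof (rule bij_betw_byWitness[where f' = "f ^^ (N * j - j)"])
    have *: "(f ^^ (N * j)) x = x" if "x \<in> E" for x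
      using md[OF that, of "N * j"] by simp
    have "j \<le> N * j" using N by simp
    then show "\<forall>x\<in>E. (f ^^ (N * j - j)) ((f ^^ j) x) = x"
      and "\<forall>x\<in>E. (f ^^ j) ((f ^^ (N * j - j)) x) = x"
      using * by (simp_all flip: funpow_add[THEN fun_cong, unfolded o_def])
  qed (use closed in auto)
  have Bij: "\<phi> j \<in> carrier (BijGroup E)" for j
    unfolding \<phi>_def BijGroup_def Bij_def using bij[of "nat j"]
    by (simp cong: bij_betw_cong)
  have "\<phi> \<in> hom ?G (BijGroup E)"
  proof (rule homI)
    fix i j assume ij: "i \<in> carrier ?G" "j \<in> carrier ?G"
    have "\<phi> ((i + j) mod int N) x = compose E (\<phi> i) (\<phi> j) x" for x
    proof (cases "x \<in> E")
      case True
      have "nat ((i + j) mod int N) = (nat i + nat j) mod N"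
        using ij by (auto simp: carr nat_mod_distrib nat_add_distrib)
      then show ?thesis using True closed
        by (simp add: \<phi>_def compose_def md funpow_add)
    qed (simp add: \<phi>_def compose_def)
    then show "\<phi> (i \<otimes>\<^bsub>?G\<^esub> j) = \<phi> i \<otimes>\<^bsub>BijGroup E\<^esub> \<phi> j"
      using Bij[of i] Bij[of j] by (auto simp: BijGroup_def)
  qed (rule Bij)
  then interpret group_action ?G E \<phi>
    by (simp add: group_action_def group_hom_def group_hom_axioms_def group_BijGroup)
  have orb: "orbit ?G \<phi> x = ?R `` {x}" if "x \<in> E" for x
  proof (intro equalityI subsetI)
    fix y assume "y \<in> orbit ?G \<phi> x"
    then show "y \<in> ?R `` {x}"
      using that closed unfolding orbit_def \<phi>_def by auto
  next
    fix y assume "y \<in> ?R `` {x}"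
    then obtain j where y: "y = (f ^^ j) x" by auto
    have "int (j mod N) \<in> carrier ?G" using N by (simp add: carr)
    moreover have "(f ^^ j) x = \<phi> (int (j mod N)) x"
      using that by (simp add: \<phi>_def md)
    ultimately show "y \<in> orbit ?G \<phi> x"
      unfolding orbit_def y by blast
  qed
  have "orbits ?G E \<phi> = orbit ?G \<phi> ` E"
    by (auto simp: orbits_def)
  also have "\<dots> = (\<lambda>x. ?R `` {x}) ` E"
    using orb by (intro image_cong) auto
  also have "\<dots> = E // ?R"
    by (simp only: quotient_def UNION_singleton_eq_range)
  finally have "orbits ?G E \<phi> = E // ?R" .
  moreover have "Coset.order ?G = N"
    by (simp add: Coset.order_def carr)
  moreover have "(\<Sum>g\<in>carrier ?G. card (invariants E \<phi> g)) =
      (\<Sum>j\<in>{0<..N}. card {x \<in> E. (f ^^ j) x = x})"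
  \<comment> \<open>The neutral element 0 is matched with the index \<open>N\<close>; every other
    group element keeps its value.\<close>
  proof (rule sum.reindex_bij_witness[where i = "\<lambda>j. int (j mod N)" and j = "\<lambda>g. if g = 0 then N else nat g"])
    fix g assume "g \<in> carrier ?G"
    then have g: "0 \<le> g" "g < int N" by (auto simp: carr)
    then show "int ((if g = 0 then N else nat g) mod N) = g"
      by (auto simp: zmod_int)
    show "(if g = 0 then N else nat g) \<in> {0<..N}" using g N by auto
    have "{x \<in> E. (f ^^ (if g = 0 then N else nat g)) x = x} = invariants E \<phi> g"
      using g per by (auto simp: invariants_def \<phi>_def)
    then show "card {x \<in> E. (f ^^ (if g = 0 then N else nat g)) x = x} = card (invariants E \<phi> g)"
      by simp
  next
    fix j assume j: "j \<in> {0<..N}"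
    then show "(if int (j mod N) = 0 then N else nat (int (j mod N))) = j"
      by (cases "j = N") auto
    show "int (j mod N) \<in> carrier ?G" using N by (simp add: carr)
  qed
  ultimately show ?thesis
    using burnside fin by (simp add: carr mult.commute)
qed

text \<open>From all subsets of \<open>I\<close> remove those inside \<open>I - J\<close>; both sums
  expand as products, and the product over \<open>I - J\<close> is a common factor. Later
  \<open>I\<close> is the set of all blocks and \<open>J\<close> the set of blocks of units.\<close>

lemma sum_subsets_meeting:
  fixes w :: "'a \<Rightarrow> 'b::comm_ring_1"
  assumes "finite I" "J \<subseteq> I"
  shows "(\<Sum>C | C \<subseteq> I \<and> C \<inter> J \<noteq> {}. \<Prod>x\<in>C. w x) =
    ((\<Prod>x\<in>J. 1 + w x) - 1) * (\<Prod>x\<in>I - J. 1 + w x)"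
proof -
  have *: "(\<Sum>C\<in>Pow A. \<Prod>x\<in>C. w x) = (\<Prod>x\<in>A. 1 + w x)" if "finite A" for A
    using prod_add[OF that, of w "\<lambda>_. 1"] by (simp add: add.commute)
  have "{C. C \<subseteq> I \<and> C \<inter> J \<noteq> {}} = Pow I - Pow (I - J)" by auto
  then have "(\<Sum>C | C \<subseteq> I \<and> C \<inter> J \<noteq> {}. \<Prod>x\<in>C. w x) =
      (\<Prod>x\<in>I. 1 + w x) - (\<Prod>x\<in>I - J. 1 + w x)"
    using assms by (simp add: sum_diff Pow_mono * finite_Diff)
  also have "(\<Prod>x\<in>I. 1 + w x) = (\<Prod>x\<in>I - J. 1 + w x) * (\<Prod>x\<in>J. 1 + w x)"
    using assms by (simp add: prod.subset_diff)
  finally show ?thesis by (simp add: algebra_simps)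
qed

lemma sum_gcd_eq_sum_divisors:
  fixes F :: "nat \<Rightarrow> 'a::comm_semiring_1"
  assumes "N > 0"
  shows "(\<Sum>j\<in>{0<..N}. F (gcd j N)) = (\<Sum>d | d dvd N. of_nat (totient (N div d)) * F d)"
proof -
  have "(\<Sum>j\<in>{0<..N}. F (gcd j N)) =
      (\<Sum>d | d dvd N. \<Sum>j | j \<in> {0<..N} \<and> gcd j N = d. F (gcd j N))"
    using assms by (intro sum.group[symmetric]) auto
  also have "\<dots> = (\<Sum>d | d dvd N. of_nat (totient (N div d)) * F d)"
    using assms by (intro sum.cong) (auto simp: card_gcd_eq_totient[symmetric])
  finally show ?thesis .
qed

lemma monom_one_sum:
  "monom (1 :: 'a::comm_semiring_1) (\<Sum>x\<in>A. h x) = (\<Prod>x\<in>A. monom 1 (h x))"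
proof (induction A rule: infinite_finite_induct)
  case (insert x A)
  then show ?case
    using mult_monom[of "1 :: 'a" "h x" 1 "sum h A"] by simp
qed simp_all

lemma closed_under_multiples:
  fixes P :: "nat \<Rightarrow> bool"
  assumes "\<And>i. P i \<Longrightarrow> P (i + s)" and "P i"
  shows "P (i + t * s)"
proof (induction t)
  case (Suc t)
  then show ?case using assms(1)[of "i + t * s"] by (simp add: add_ac)
qed (use assms in simp)

lemma smult_sum_right: "smult c (\<Sum>i\<in>A. f i) = (\<Sum>i\<in>A. smult c (f i))"
  by (induction A rule: infinite_finite_induct) (simp_all add: smult_add_right)

subsection \<open>Residues modulo an odd prime power\<close>

text \<open>As the same \<open>r\<close> is a primitive root modulo every
  \<open>p ^ (m - k)\<close>, multiplication by \<open>r\<close> runs cyclically through the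
  residues of each valuation \<open>k < m\<close>.\<close>

locale odd_prime_power =
  fixes p m r :: nat
  assumes p: "Factorial_Ring.prime p" "odd p" and m: "m \<ge> 1"
    and r: "\<And>k. k > 0 \<Longrightarrow> residue_primroot (p ^ k) r"
begin

definition n :: nat where "n = p ^ m"

text \<open>For \<open>k < m\<close> this is the number of pairs {x, -x} of residues of p-adic
  valuation \<open>k\<close>.\<close>

definition N :: "nat \<Rightarrow> nat" where "N k = totient (p ^ (m - k)) div 2"

text \<open>The nonzero residues are exactly the \<open>elt k i\<close> with \<open>k < m\<close>, where the exponent \<open>i\<close> matters
  modulo \<open>2 * N k\<close>. Multiplication by \<open>r\<close> increments \<open>i\<close>, and negation adds \<open>N k\<close> to it.\<close>

definition elt :: "nat \<Rightarrow> nat \<Rightarrow> int" where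
  "elt k i = int ((p ^ k * r ^ i) mod n)"

lemma p_gt_2: "p > 2"
  using p prime_gt_1_nat[of p] by (cases "p = 2") auto

lemma n_gt_2: "n > 2"
proof -
  have "p ^ 1 \<le> p ^ m" using m p_gt_2 by (intro power_increasing) auto
  then show ?thesis using p_gt_2 by (simp add: n_def)
qed

lemma totient_layer: "k < m \<Longrightarrow> totient (p ^ (m - k)) = 2 * N k"
proof -
  assume "k < m"
  then have "p ^ 1 \<le> p ^ (m - k)" using p_gt_2 by (intro power_increasing) auto
  then have "even (totient (p ^ (m - k)))" using p_gt_2 by (intro totient_even) simp
  then show ?thesis by (simp add: N_def)
qed

lemma N_pos: "k < m \<Longrightarrow> N k > 0"
  using totient_layer[of k] p_gt_2 by (metis gr0I mult_0_right totient_0_iff power_not_zero not_less_zero)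

lemma N_0: "k < m \<Longrightarrow> N 0 = p ^ k * N k"
proof -
  assume k: "k < m"
  have "2 * N 0 = p ^ (m - 1) * (p - 1)"
    using totient_layer[of 0] k p by (simp add: totient_prime_power)
  also have "p ^ (m - 1) = p ^ k * p ^ (m - k - 1)"
    using k by (simp flip: power_add)
  also have "\<dots> * (p - 1) = p ^ k * totient (p ^ (m - k))"
    using k p by (simp add: totient_prime_power)
  also have "\<dots> = 2 * (p ^ k * N k)"
    using k by (simp add: totient_layer)
  finally show ?thesis by simp
qed

lemma coprime_r: "coprime p r"
  using r[of 1] by (simp add: residue_primroot_def)

text \<open>Cancelling \<open>p ^ k\<close> leaves powers of \<open>r\<close> modulo
  \<open>p ^ (m - k)\<close>, where the order of \<open>r\<close> is the full totient
  \<open>2 * N k\<close>.\<close>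

lemma elt_eq_iff: "k < m \<Longrightarrow> elt k i = elt k j \<longleftrightarrow> [i = j] (mod 2 * N k)"
proof -
  assume k: "k < m"
  have "elt k i = elt k j \<longleftrightarrow> [p ^ k * r ^ i = p ^ k * r ^ j] (mod p ^ k * p ^ (m - k))"
    using k by (simp add: elt_def cong_def n_def flip: power_add)
  also have "\<dots> \<longleftrightarrow> [r ^ i = r ^ j] (mod p ^ (m - k))"
    using p_gt_2 by (simp add: cong_def)
  also have "\<dots> \<longleftrightarrow> [i = j] (mod ord (p ^ (m - k)) r)"
    using coprime_r by (intro order_divides_expdiff) simp
  also have "ord (p ^ (m - k)) r = 2 * N k"
    using r[of "m - k"] k by (simp add: residue_primroot_def totient_layer)
  finally show ?thesis .
qed

lemma elt_mult: "int r ^ j * elt k i mod int n = elt k (i + j)"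
  by (simp add: elt_def mod_mult_right_eq power_add mult_ac flip: of_nat_power of_nat_mult of_nat_mod)

lemma p_dvd_elt: "0 < k \<Longrightarrow> int p dvd elt k i"
proof -
  assume "0 < k"
  moreover have "p dvd n" using m by (simp add: n_def)
  ultimately show ?thesis unfolding elt_def by (simp add: dvd_mod_iff)
qed

text \<open>The order of \<open>r\<close> modulo \<open>n\<close> is \<open>2 * N 0\<close>, so
  \<open>n\<close> divides \<open>(r ^ N 0 - 1) * (r ^ N 0 + 1)\<close> but not the first factor. An
  odd prime cannot divide both factors, so \<open>n\<close> divides one of them entirely.\<close>

lemma r_power_N: "[int r ^ N 0 = -1] (mod int n)"
proof -
  have "[r ^ (2 * N 0) = 1] (mod n)" and ne: "\<not> [r ^ N 0 = 1] (mod n)"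
    using elt_eq_iff[of 0 "2 * N 0" 0] elt_eq_iff[of 0 "N 0" 0] N_pos[of 0] m
    by (auto simp: elt_def cong_def)
  then have "[int r ^ (2 * N 0) = 1] (mod int n)"
    using cong_int_iff[of "r ^ (2 * N 0)" 1 n] by simp
  then have dvd: "int n dvd (int r ^ N 0 - 1) * (int r ^ N 0 + 1)"
    by (simp add: cong_iff_dvd_diff algebra_simps flip: power_add mult_2)
  have nd: "\<not> int n dvd int r ^ N 0 - 1"
    using ne cong_int_iff[of "r ^ N 0" 1 n] by (simp add: cong_iff_dvd_diff)
  have ip: "Factorial_Ring.prime (int p)" using p by simp
  show ?thesis
  proof (cases "int p dvd int r ^ N 0 + 1")
    case True
    have "\<not> int p dvd int r ^ N 0 - 1"
    proof
      assume "int p dvd int r ^ N 0 - 1"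
      with True have "int p dvd (int r ^ N 0 + 1) - (int r ^ N 0 - 1)" by (rule dvd_diff)
      then have "int p dvd 2" by simp
      then show False using p_gt_2 zdvd_imp_le by fastforce
    qed
    then have "coprime (int n) (int r ^ N 0 - 1)"
      using ip by (simp add: n_def prime_imp_coprime)
    then show ?thesis
      using dvd by (simp add: cong_iff_dvd_diff coprime_dvd_mult_right_iff)
  next
    case False
    then have "coprime (int n) (int r ^ N 0 + 1)"
      using ip by (simp add: n_def prime_imp_coprime)
    then show ?thesis
      using dvd nd by (simp add: coprime_dvd_mult_left_iff)
  qed
qed

lemma elt_pos: "k < m \<Longrightarrow> elt k i \<in> {1..<int n}"
proof -
  assume k: "k < m"
  have "\<not> n dvd p ^ k * r ^ i"
  proof
    assume "n dvd p ^ k * r ^ i"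
    then have "p ^ k * p ^ (m - k) dvd p ^ k * r ^ i"
      using k by (simp add: n_def flip: power_add)
    then have "p ^ (m - k) dvd r ^ i" using p_gt_2 by simp
    moreover have "p dvd p ^ (m - k)" using k by simp
    ultimately have "p dvd r ^ i" by (rule dvd_trans[rotated])
    then show False
      using coprime_r p by (metis coprime_absorb_left coprime_power_right_iff not_prime_unit)
  qed
  then have "(p ^ k * r ^ i) mod n \<noteq> 0" by (simp add: dvd_eq_mod_eq_0)
  then show ?thesis using n_gt_2 by (simp add: elt_def del: of_nat_mod)
qed

lemma elt_add_N0: "k < m \<Longrightarrow> elt k (i + N 0) = int n - elt k i"
proof -
  assume k: "k < m"
  have "elt k (i + N 0) = int r ^ N 0 * elt k i mod int n" by (simp add: elt_mult)
  also have "\<dots> = (- elt k i) mod int n"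
    using cong_mult[OF r_power_N cong_refl[of "elt k i"]] by (simp add: cong_def)
  also have "\<dots> = (int n - elt k i) mod int n"
    by (metis diff_conv_add_uminus add.commute mod_add_self2)
  also have "\<dots> = int n - elt k i"
    using elt_pos[OF k, of i] by (intro mod_pos_pos_trivial) auto
  finally show ?thesis .
qed

text \<open>Negation shifts the exponent by \<open>N 0 = p ^ k * N k\<close>. As
  \<open>p ^ k\<close> is odd, this is congruent to \<open>N k\<close> modulo
  \<open>2 * N k\<close>, the period of layer \<open>k\<close>.\<close>

lemma elt_add_N: "k < m \<Longrightarrow> elt k (i + N k) = int n - elt k i"
proof -
  assume k: "k < m"
  have "[p ^ k = 1] (mod 2)" using p by (simp add: cong_def mod2_eq_if)
  then have "[N k * p ^ k = N k * 1] (mod N k * 2)"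
    by (simp add: cong_def flip: mult_mod_right)
  then have "[i + N k = i + N 0] (mod 2 * N k)"
    using k by (intro cong_add) (auto simp: N_0 mult_ac cong_sym)
  then have "elt k (i + N k) = elt k (i + N 0)"
    using k by (simp add: elt_eq_iff)
  then show ?thesis using k by (simp add: elt_add_N0)
qed

text \<open>If \<open>k < l\<close>, then modulo \<open>p ^ Suc k\<close>, a divisor of
  \<open>n\<close>, the element of layer \<open>l\<close> vanishes while that of layer
  \<open>k\<close> does not.\<close>

lemma elt_layer_unique: "k < m \<Longrightarrow> l < m \<Longrightarrow> elt k i = elt l j \<Longrightarrow> k = l"
proof (induction k l arbitrary: i j rule: linorder_wlog)
  case (le k l)
  show ?case
  proof (rule ccontr)
    assume "k \<noteq> l"
    with le have kl: "k < l" by simp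
    have "p ^ Suc k dvd n" using le by (simp add: n_def le_imp_power_dvd flip: power_Suc)
    moreover have "[p ^ k * r ^ i = p ^ l * r ^ j] (mod n)"
      using le by (simp add: elt_def cong_def)
    ultimately have "[p ^ k * r ^ i = p ^ l * r ^ j] (mod p ^ Suc k)"
      by (rule cong_dvd_modulus_nat[rotated])
    moreover have "p ^ Suc k dvd p ^ l * r ^ j"
      using kl by (intro dvd_mult2 le_imp_power_dvd) simp
    ultimately have "p ^ k * p dvd p ^ k * r ^ i"
      using cong_dvd_iff by (metis cong_0_iff cong_sym cong_trans power_Suc2)
    then have "p dvd r ^ i" using p_gt_2 by simp
    then show False
      using coprime_r p by (metis coprime_absorb_left coprime_power_right_iff not_prime_unit)
  qed
qed metis

text \<open>Split off the exact power \<open>p ^ k\<close> of \<open>p\<close> in \<open>x\<close>;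
  the cofactor is a unit modulo \<open>p ^ (m - k)\<close>, hence a power of \<open>r\<close>
  there.\<close>

lemma ex_elt: "x \<in> {1..<int n} \<Longrightarrow> \<exists>k<m. \<exists>i. x = elt k i"
proof -
  assume x: "x \<in> {1..<int n}"
  define k where "k = multiplicity p (nat x)"
  have "nat x \<noteq> 0" using x by auto
  then obtain y where y: "nat x = p ^ k * y" "\<not> p dvd y"
    using p by (metis multiplicity_decompose' not_prime_unit k_def)
  have "p ^ k * 1 \<le> nat x" unfolding y using y by (intro mult_le_mono2) (auto intro: Suc_leI gr0I)
  also have "\<dots> < p ^ m" using x by (auto simp: n_def nat_less_iff)
  finally have k: "k < m" using p_gt_2 by simp
  have gt1: "p ^ (m - k) > 1" using k p_gt_2 by (intro one_less_power) auto
  have "coprime y (p ^ (m - k))"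
    using y p by (simp add: prime_imp_coprime coprime_commute)
  then have "coprime (y mod p ^ (m - k)) (p ^ (m - k))"
    using p_gt_2 by (subst coprime_mod_left_iff) auto
  moreover have "y mod p ^ (m - k) \<noteq> 0"
    using y k by (metis dvd_eq_mod_eq_0 dvd_power dvd_trans zero_less_diff)
  moreover have "y mod p ^ (m - k) \<le> p ^ (m - k)"
    using gt1 by (intro mod_le_divisor) linarith
  ultimately have "y mod p ^ (m - k) \<in> totatives (p ^ (m - k))"
    by (simp add: totatives_def)
  then obtain i where "y mod p ^ (m - k) = r ^ i mod p ^ (m - k)"
    using residue_primroot_is_generator[OF gt1 r] k by (auto simp: bij_betw_def)
  then have "[p ^ k * y = p ^ k * r ^ i] (mod p ^ k * p ^ (m - k))"
    by (simp add: cong_def)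
  then have "nat x mod n = (p ^ k * r ^ i) mod n"
    using k y by (simp add: cong_def n_def flip: power_add)
  moreover have "nat x mod n = nat x" using x by (auto simp: nat_less_iff)
  ultimately have "int (nat x) = elt k i" unfolding elt_def by simp
  then have "x = elt k i" using x by simp
  then show ?thesis using k by blast
qed

subsection \<open>Connection sets fixed by a power of the primitive root\<close>

definition rot :: "int set \<Rightarrow> int set" where
  "rot \<Omega> = (\<lambda>x. int r * x mod int n) ` \<Omega>"

text \<open>The Cayley sets of the cyclic group in terms of residues, as
  \<open>cayley_sets_Zn\<close> shows. The \<open>elt 0 i\<close> are the units, and containing one
  of them stands for generating the group.\<close>

definition conn_sets :: "int set set" where
  "conn_sets = {\<Omega>. \<Omega> \<subseteq> {1..<int n} \<and> (\<forall>x\<in>\<Omega>. int n - x \<in> \<Omega>) \<and> (\<exists>i. elt 0 i \<in> \<Omega>)}"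

lemma finite_conn_sets [simp]: "finite conn_sets"
  unfolding conn_sets_def by (rule finite_subset[of _ "Pow {1..<int n}"]) auto

lemma conn_set_finite: "\<Omega> \<in> conn_sets \<Longrightarrow> finite \<Omega>"
  unfolding conn_sets_def by (auto intro: finite_subset)

lemma rot_funpow_image:
  "\<Omega> \<subseteq> {1..<int n} \<Longrightarrow> (rot ^^ j) \<Omega> = (\<lambda>x. int r ^ j * x mod int n) ` \<Omega>"
proof (induction j)
  case 0
  then have "(\<lambda>x. x mod int n) ` \<Omega> = (\<lambda>x. x) ` \<Omega>"
    by (intro image_cong) auto
  then show ?case by simp
next
  case (Suc j)
  then show ?case by (simp add: rot_def image_image mod_mult_right_eq mult.assoc)
qed

lemma rot_funpow:
  assumes "\<Omega> \<subseteq> {1..<int n}"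
  shows "(rot ^^ j) \<Omega> = {elt k (i + j) | k i. k < m \<and> elt k i \<in> \<Omega>}"
  unfolding rot_funpow_image[OF assms]
proof (intro equalityI subsetI)
  fix x assume "x \<in> (\<lambda>x. int r ^ j * x mod int n) ` \<Omega>"
  then obtain y where y: "y \<in> \<Omega>" "x = int r ^ j * y mod int n" by auto
  then obtain k i where "k < m" "y = elt k i" using assms ex_elt by (meson subsetD)
  then have "x = elt k (i + j)" "k < m" "elt k i \<in> \<Omega>" using y by (simp_all add: elt_mult)
  then show "x \<in> {elt k (i + j) | k i. k < m \<and> elt k i \<in> \<Omega>}" by blast
next
  fix x assume "x \<in> {elt k (i + j) | k i. k < m \<and> elt k i \<in> \<Omega>}"
  then obtain k i where "x = elt k (i + j)" "elt k i \<in> \<Omega>" by auto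
  then show "x \<in> (\<lambda>x. int r ^ j * x mod int n) ` \<Omega>"
    by (intro image_eqI[where x = "elt k i"]) (simp_all add: elt_mult)
qed

lemma inj_on_mult_r: "inj_on (\<lambda>x. int r ^ j * x mod int n) {0..<int n}"
proof (rule inj_onI)
  fix x y assume xy: "x \<in> {0..<int n}" "y \<in> {0..<int n}"
    and "int r ^ j * x mod int n = int r ^ j * y mod int n"
  moreover have "coprime (int r ^ j) (int n)"
    using coprime_r by (simp add: n_def coprime_commute)
  ultimately have "[x = y] (mod int n)"
    using cong_mult_lcancel by (metis cong_def)
  then show "x = y" using xy by (simp add: cong_def)
qed

lemma card_rot_funpow:
  assumes "\<Omega> \<subseteq> {1..<int n}"
  shows "card ((rot ^^ j) \<Omega>) = card \<Omega>"
  unfolding rot_funpow_image[OF assms] using assms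
  by (intro card_image inj_on_subset[OF inj_on_mult_r]) auto

lemma rot_conn_sets:
  assumes "\<Omega> \<in> conn_sets"
  shows "rot \<Omega> \<in> conn_sets"
proof -
  have sub: "\<Omega> \<subseteq> {1..<int n}" using assms by (simp add: conn_sets_def)
  have rot: "rot \<Omega> = {elt k (i + 1) | k i. k < m \<and> elt k i \<in> \<Omega>}"
    using rot_funpow[OF sub, of 1] by simp
  show ?thesis
    unfolding conn_sets_def
  proof (intro CollectI conjI ballI)
    show "rot \<Omega> \<subseteq> {1..<int n}" unfolding rot using elt_pos by blast
    obtain i where "elt 0 i \<in> \<Omega>" using assms by (auto simp: conn_sets_def)
    then have "elt 0 (i + 1) \<in> rot \<Omega>" unfolding rot using m by fastforce
    then show "\<exists>i. elt 0 i \<in> rot \<Omega>" ..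
    fix x assume "x \<in> rot \<Omega>"
    then obtain k i where ki: "k < m" "elt k i \<in> \<Omega>" "x = elt k (i + 1)" unfolding rot by auto
    then have "elt k (i + N k) \<in> \<Omega>" using assms by (simp add: conn_sets_def elt_add_N)
    then have "elt k ((i + N k) + 1) \<in> rot \<Omega>" unfolding rot using ki by blast
    moreover have "elt k ((i + N k) + 1) = int n - x"
      using elt_add_N[OF ki(1), of "i + 1"] ki by (simp add: add_ac)
    ultimately show "int n - x \<in> rot \<Omega>" by simp
  qed
qed

text \<open>Multiplication by \<open>r ^ N 0\<close> is negation, which maps a symmetric set into
  itself; equal finite cardinalities turn the inclusion into equality.\<close>

lemma rot_funpow_N:
  assumes "\<Omega> \<in> conn_sets"
  shows "(rot ^^ N 0) \<Omega> = \<Omega>"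
proof -
  have sub: "\<Omega> \<subseteq> {1..<int n}" using assms by (simp add: conn_sets_def)
  have "(rot ^^ N 0) \<Omega> \<subseteq> \<Omega>"
    unfolding rot_funpow[OF sub] using assms by (auto simp: elt_add_N0 conn_sets_def)
  then show ?thesis
    using card_rot_funpow[OF sub] conn_set_finite[OF assms] by (intro card_subset_eq)
qed

text \<open>The exponents of layer \<open>k\<close> occurring in \<open>\<Omega>\<close> are closed
  under adding \<open>j\<close>, as \<open>\<Omega>\<close> is fixed, and under adding
  \<open>N k\<close>, as it is symmetric; by Bezout they are closed under adding the gcd.\<close>

lemma fixed_closed:
  assumes \<Omega>: "\<Omega> \<in> conn_sets" and fixd: "(rot ^^ j) \<Omega> = \<Omega>" and j: "j > 0" and k: "k < m"
    and cong: "[i = i'] (mod gcd j (N k))" and i: "elt k i \<in> \<Omega>"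
  shows "elt k i' \<in> \<Omega>"
proof -
  let ?g = "gcd j (N k)"
  have sub: "\<Omega> \<subseteq> {1..<int n}" using \<Omega> by (simp add: conn_sets_def)
  have step_j: "elt k (i + j) \<in> \<Omega>" if "elt k i \<in> \<Omega>" for i
    using that k rot_funpow[OF sub, of j] fixd by blast
  have step_N: "elt k (i + N k) \<in> \<Omega>" if "elt k i \<in> \<Omega>" for i
    using that \<Omega> k by (simp add: conn_sets_def elt_add_N)
  have iter_j: "elt k (i + a * j) \<in> \<Omega>" if "elt k i \<in> \<Omega>" for i a
    using step_j that by (rule closed_under_multiples)
  have iter_N: "elt k (i + a * N k) \<in> \<Omega>" if "elt k i \<in> \<Omega>" for i a
    using step_N that by (rule closed_under_multiples)
  \<comment> \<open>Instead of subtracting \<open>b * N k\<close>, it is added once more: the shift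
    then exceeds the gcd by \<open>b * (2 * N k)\<close>, a multiple of the period.\<close>
  obtain a b where ab: "j * a = N k * b + ?g"
    using bezout_nat[of j "N k"] j by auto
  have step_g: "elt k (i + ?g) \<in> \<Omega>" if "elt k i \<in> \<Omega>" for i
  proof -
    have "elt k ((i + a * j) + b * N k) \<in> \<Omega>"
      using that by (intro iter_N iter_j)
    moreover have "(i + a * j) + b * N k = (i + ?g) + b * (2 * N k)"
      using ab by (simp add: algebra_simps)
    moreover have "elt k ((i + ?g) + b * (2 * N k)) = elt k (i + ?g)"
      using k by (simp add: elt_eq_iff cong_def)
    ultimately show ?thesis by simp
  qed
  have iter_g: "elt k (i + t * ?g) \<in> \<Omega>" if "elt k i \<in> \<Omega>" for i t
    using step_g that by (rule closed_under_multiples)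
  \<comment> \<open>Raising \<open>i'\<close> by a multiple of the period makes it at least
    \<open>i\<close>, so that it is reached from \<open>i\<close> by adding multiples of the
    gcd.\<close>
  have le: "i \<le> i' + i * (2 * N k)"
    using N_pos[OF k] by (simp add: trans_le_add2)
  have "[i' + i * (2 * N k) = i' + 0] (mod ?g)"
    by (intro cong_add) (auto simp: cong_0_iff)
  then have "[i' + i * (2 * N k) = i] (mod ?g)"
    using cong by (simp add: cong_def)
  then have "?g dvd i' + i * (2 * N k) - i"
    using le by (simp add: cong_altdef_nat)
  then obtain t where "i' + i * (2 * N k) = i + t * ?g"
    using le by (metis dvdE le_add_diff_inverse mult.commute)
  then have "elt k (i' + i * (2 * N k)) \<in> \<Omega>"
    using iter_g[OF i] by simp
  moreover have "elt k (i' + i * (2 * N k)) = elt k i'"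
    using k by (simp add: elt_eq_iff cong_def)
  ultimately show ?thesis by simp
qed

text \<open>The pair \<open>(k, c)\<close> stands for the orbit \<open>{elt k i | i. i mod gcd j (N k) = c}\<close> under multiplication
  by \<open>r ^ j\<close> and by \<open>-1\<close>.\<close>

definition blocks :: "nat \<Rightarrow> (nat \<times> nat) set" where
  "blocks j = (SIGMA k:{..<m}. {..<gcd j (N k)})"

definition block_union :: "nat \<Rightarrow> (nat \<times> nat) set \<Rightarrow> int set" where
  "block_union j C = {elt k i | k i. k < m \<and> (k, i mod gcd j (N k)) \<in> C}"

text \<open>Layers are disjoint, and \<open>gcd j (N k)\<close> divides the period
  \<open>2 * N k\<close>, so the class of the exponent depends only on the element.\<close>

lemma elt_mem_block_union:
  assumes "k < m"
  shows "elt k i \<in> block_union j C \<longleftrightarrow> (k, i mod gcd j (N k)) \<in> C"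
proof
  assume "elt k i \<in> block_union j C"
  then obtain l i' where l: "l < m" "elt k i = elt l i'" "(l, i' mod gcd j (N l)) \<in> C"
    unfolding block_union_def by auto
  then have [simp]: "l = k" using elt_layer_unique assms by metis
  have "[i = i'] (mod 2 * N k)" using l assms by (simp add: elt_eq_iff)
  then have "[i = i'] (mod gcd j (N k))" by (rule cong_dvd_modulus_nat) simp
  then show "(k, i mod gcd j (N k)) \<in> C" using l by (simp add: cong_def)
qed (use assms in \<open>auto simp: block_union_def\<close>)

text \<open>With g the gcd, the exponents below \<open>2 * N k\<close> in class \<open>c\<close>
  modulo g are \<open>c + g * t\<close> with \<open>t < 2 * N k div g\<close>, so each block has
  \<open>2 * N k div g\<close> elements, and distinct blocks are disjoint.\<close>

lemma card_block_union:
  assumes j: "j > 0" and C: "C \<subseteq> blocks j"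
  shows "card (block_union j C) = (\<Sum>(k, c)\<in>C. 2 * N k div gcd j (N k))"
proof -
  let ?g = "\<lambda>k. gcd j (N k)"
  have g: "?g k > 0" for k using j by simp
  have mem: "k < m" "c < ?g k" if "(k, c) \<in> C" for k c
    using that C by (auto simp: blocks_def)
  have dv: "?g k * (2 * N k div ?g k) = 2 * N k" for k by simp
  \<comment> \<open>Exponents below the period are determined by their congruence class, which gives
    injectivity.\<close>
  have lt: "c + ?g k * t < 2 * N k" if "c < ?g k" "t < 2 * N k div ?g k" for c k t
  proof -
    have "c + ?g k * t < ?g k * (t + 1)" using that by simp
    also have "\<dots> \<le> ?g k * (2 * N k div ?g k)" using that by (intro mult_le_mono2) simp
    finally show ?thesis by (simp only: dv)
  qed
  have "bij_betw (\<lambda>((k, c), t). elt k (c + ?g k * t))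
    (SIGMA x:C. {..<2 * N (fst x) div ?g (fst x)}) (block_union j C)"
    unfolding bij_betw_def
  proof
    show "inj_on (\<lambda>((k, c), t). elt k (c + ?g k * t)) (SIGMA x:C. {..<2 * N (fst x) div ?g (fst x)})"
    proof (rule inj_onI, clarsimp)
      fix k c t k' c' t'
      assume *: "(k, c) \<in> C" "(k', c') \<in> C" "t < 2 * N k div ?g k" "t' < 2 * N k' div ?g k'"
        "elt k (c + ?g k * t) = elt k' (c' + ?g k' * t')"
      have [simp]: "k' = k" using elt_layer_unique * mem by metis
      have "[c + ?g k * t = c' + ?g k * t'] (mod 2 * N k)"
        using * mem by (simp add: elt_eq_iff)
      then have eq: "c + ?g k * t = c' + ?g k * t'"
        using * mem lt by (intro cong_less_modulus_unique_nat) auto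
      then have "(c + ?g k * t) mod ?g k = (c' + ?g k * t') mod ?g k" by simp
      then have "c = c'" using * mem by auto
      then show "k = k' \<and> c = c' \<and> t = t'" using eq j by simp
    qed
    show "(\<lambda>((k, c), t). elt k (c + ?g k * t)) ` (SIGMA x:C. {..<2 * N (fst x) div ?g (fst x)}) = block_union j C"
    proof (intro equalityI subsetI)
      fix x assume "x \<in> block_union j C"
      then obtain k i where ki: "k < m" "x = elt k i" "(k, i mod ?g k) \<in> C"
        unfolding block_union_def by auto
      \<comment> \<open>Reducing the exponent modulo the period keeps the element and bounds the
        quotient that serves as \<open>t\<close>.\<close>
      define i' where "i' = i mod (2 * N k)"
      have "elt k i = elt k i'" using ki by (simp add: elt_eq_iff i'_def cong_def)
      moreover have "i' mod ?g k = i mod ?g k"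
        unfolding i'_def by (simp add: mod_mod_cancel)
      moreover have "i' div ?g k < 2 * N k div ?g k"
        using N_pos[OF ki(1)] g[of k] dv[of k] unfolding i'_def
        by (simp add: div_less_iff_less_mult mult.commute)
      ultimately show "x \<in> (\<lambda>((k, c), t). elt k (c + ?g k * t)) ` (SIGMA x:C. {..<2 * N (fst x) div ?g (fst x)})"
        using ki by (intro image_eqI[where x = "((k, i mod ?g k), i' div ?g k)"])
          (auto, metis mod_mult_div_eq)
    next
      fix x assume "x \<in> (\<lambda>((k, c), t). elt k (c + ?g k * t)) ` (SIGMA x:C. {..<2 * N (fst x) div ?g (fst x)})"
      then obtain k c t where "(k, c) \<in> C" "x = elt k (c + ?g k * t)" by auto
      then show "x \<in> block_union j C"
        using mem[of k c] by (simp add: elt_mem_block_union)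
    qed
  qed
  then have "card (block_union j C) = card (SIGMA x:C. {..<2 * N (fst x) div ?g (fst x)})"
    by (rule bij_betw_same_card[symmetric])
  also have "\<dots> = (\<Sum>x\<in>C. 2 * N (fst x) div ?g (fst x))"
    using finite_subset[OF C] by (subst card_SigmaI) (auto simp: blocks_def)
  finally show ?thesis by (simp add: case_prod_beta)
qed

text \<open>Both \<open>j\<close> and \<open>N k\<close> vanish modulo \<open>gcd j (N k)\<close>,
  so multiplication by \<open>r ^ j\<close> and negation preserve every block; the block
  \<open>(0, c)\<close> supplies a unit.\<close>

lemma block_union_fixed:
  assumes j: "j > 0" and C: "C \<subseteq> blocks j" and C0: "(0, c) \<in> C"
  shows "block_union j C \<in> conn_sets" "(rot ^^ j) (block_union j C) = block_union j C"
proof -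
  have sub: "block_union j C \<subseteq> {1..<int n}"
    unfolding block_union_def using elt_pos by blast
  show "block_union j C \<in> conn_sets"
    unfolding conn_sets_def
  proof (intro CollectI conjI ballI)
    have "c < gcd j (N 0)" using C C0 by (auto simp: blocks_def)
    then have "elt 0 c \<in> block_union j C" using m C0 by (simp add: elt_mem_block_union)
    then show "\<exists>i. elt 0 i \<in> block_union j C" ..
    fix x assume "x \<in> block_union j C"
    then obtain k i where ki: "k < m" "x = elt k i" "(k, i mod gcd j (N k)) \<in> C"
      unfolding block_union_def by auto
    moreover have "(i + N k) mod gcd j (N k) = i mod gcd j (N k)"
      by (metis add.right_neutral gcd_dvd2 mod_add_right_eq mod_0_imp_dvd dvd_imp_mod_0)
    ultimately have "elt k (i + N k) \<in> block_union j C"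
      by (simp add: elt_mem_block_union)
    then show "int n - x \<in> block_union j C" using ki by (simp add: elt_add_N)
  qed (rule sub)
  have "(rot ^^ j) (block_union j C) \<subseteq> block_union j C"
  proof
    fix x assume "x \<in> (rot ^^ j) (block_union j C)"
    then obtain k i where ki: "k < m" "x = elt k (i + j)" "elt k i \<in> block_union j C"
      unfolding rot_funpow[OF sub] by auto
    moreover have "(i + j) mod gcd j (N k) = i mod gcd j (N k)"
      by (metis add.right_neutral gcd_dvd1 mod_add_right_eq dvd_imp_mod_0)
    ultimately show "x \<in> block_union j C"
      by (simp add: elt_mem_block_union)
  qed
  then show "(rot ^^ j) (block_union j C) = block_union j C"
    using card_rot_funpow[OF sub] finite_subset[OF sub] by (intro card_subset_eq) auto
qed

text \<open>Generating function by cardinality of the connection sets fixed by \<open>r ^ j\<close>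
  when \<open>gcd j (N 0) = d\<close>. The subtracted 1 excludes the choice of no block of
  units.\<close>

definition fixed_gf :: "nat \<Rightarrow> real poly" where
  "fixed_gf d = ((1 + monom 1 (2 * N 0 div d)) ^ d - 1) *
    (\<Prod>k = 1..m - 1. (1 + monom 1 (2 * N k div gcd d (N k))) ^ gcd d (N k))"

text \<open>Fixed connection sets correspond to sets of blocks that include a block of units. Sizes
  of blocks add up, so the monomials multiply, and the sum over sets of blocks factors.\<close>

lemma sum_fixed:
  assumes j: "j > 0"
  shows "(\<Sum>\<Omega> | \<Omega> \<in> conn_sets \<and> (rot ^^ j) \<Omega> = \<Omega>. monom 1 (card \<Omega>)) = fixed_gf (gcd j (N 0))"
proof -
  let ?g = "\<lambda>k. gcd j (N k)"
  let ?w = "\<lambda>(k, c). monom (1::real) (2 * N k div ?g k)"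
  let ?J = "{0} \<times> {..<?g 0}"
  have sub: "?J \<subseteq> blocks j" using m by (auto simp: blocks_def)
  have fin: "finite (blocks j)" by (simp add: blocks_def)
  have "(\<Sum>\<Omega> | \<Omega> \<in> conn_sets \<and> (rot ^^ j) \<Omega> = \<Omega>. monom 1 (card \<Omega>)) =
    (\<Sum>C | C \<subseteq> blocks j \<and> C \<inter> ?J \<noteq> {}. \<Prod>x\<in>C. ?w x)"
  proof (rule sum.reindex_bij_witness[where i = "block_union j"
        and j = "\<lambda>\<Omega>. {(k, c) \<in> blocks j. elt k c \<in> \<Omega>}"])
    fix C assume "C \<in> {C. C \<subseteq> blocks j \<and> C \<inter> ?J \<noteq> {}}"
    then obtain c where C: "C \<subseteq> blocks j" "(0, c) \<in> C" by auto
    show "{(k, c) \<in> blocks j. elt k c \<in> block_union j C} = C"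
      using C by (auto simp: blocks_def elt_mem_block_union) 
    show "block_union j C \<in> {\<Omega> \<in> conn_sets. (rot ^^ j) \<Omega> = \<Omega>}"
      using block_union_fixed[OF j C] by simp
  next
    fix \<Omega> assume "\<Omega> \<in> {\<Omega> \<in> conn_sets. (rot ^^ j) \<Omega> = \<Omega>}"
    then have \<Omega>: "\<Omega> \<in> conn_sets" "(rot ^^ j) \<Omega> = \<Omega>" by auto
    let ?C = "{(k, c) \<in> blocks j. elt k c \<in> \<Omega>}"
    \<comment> \<open>A fixed set contains either all or none of a block, so testing the
      representative \<open>c\<close> recovers its blocks.\<close>
    have iff: "elt k (i mod ?g k) \<in> \<Omega> \<longleftrightarrow> elt k i \<in> \<Omega>" if "k < m" for k i
      using fixed_closed[OF \<Omega> j that, of i "i mod ?g k"] fixed_closed[OF \<Omega> j that, of "i mod ?g k" i]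
      by (auto simp: cong_def)
    have sub\<Omega>: "\<Omega> \<subseteq> {1..<int n}" using \<Omega> by (simp add: conn_sets_def)
    have mem: "elt k i \<in> block_union j ?C \<longleftrightarrow> elt k i \<in> \<Omega>" if "k < m" for k i
      using that j by (simp add: elt_mem_block_union blocks_def iff)
    have "block_union j ?C \<subseteq> {1..<int n}"
      unfolding block_union_def using elt_pos by auto
    then have out: "x \<notin> block_union j ?C \<and> x \<notin> \<Omega>" if "x \<notin> {1..<int n}" for x
      using sub\<Omega> that by blast
    have "x \<in> block_union j ?C \<longleftrightarrow> x \<in> \<Omega>" for x
    proof (cases "x \<in> {1..<int n}")
      case True
      then obtain k i where "k < m" "x = elt k i" using ex_elt by blast
      then show ?thesis using mem[of k i] by simp
    next
      case False
      then show ?thesis using out[of x] by simp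
    qed
    then show eq: "block_union j ?C = \<Omega>" by blast
    obtain i where "elt 0 i \<in> \<Omega>" using \<Omega> by (auto simp: conn_sets_def)
    then have "(0, i mod ?g 0) \<in> ?C \<inter> ?J" using m j iff[of 0] by (auto simp: blocks_def)
    then show "?C \<in> {C. C \<subseteq> blocks j \<and> C \<inter> ?J \<noteq> {}}" by blast
    have "card \<Omega> = (\<Sum>(k, c)\<in>?C. 2 * N k div ?g k)"
      using card_block_union[OF j, of ?C] unfolding eq by auto
    then show "(\<Prod>x\<in>?C. ?w x) = monom 1 (card \<Omega>)"
      by (simp add: monom_one_sum case_prod_beta)
  qed
  also have "\<dots> = ((\<Prod>x\<in>?J. 1 + ?w x) - 1) * (\<Prod>x\<in>blocks j - ?J. 1 + ?w x)"
    by (rule sum_subsets_meeting[OF fin sub])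
  also have "(\<Prod>x\<in>?J. 1 + ?w x) = (1 + monom 1 (2 * N 0 div ?g 0)) ^ ?g 0"
  proof -
    have "(\<Prod>x\<in>?J. 1 + ?w x) = (\<Prod>c<?g 0. 1 + ?w (0, c))"
      by (rule prod.reindex_bij_witness[of _ "Pair 0" snd]) auto
    then show ?thesis by simp
  qed
  also have "blocks j - ?J = (SIGMA k:{1..m - 1}. {..<?g k})"
    using m by (auto simp: blocks_def Suc_le_eq)
  also have "(\<Prod>x\<in>\<dots>. 1 + ?w x) = (\<Prod>(k, c)\<in>(SIGMA k:{1..m - 1}. {..<?g k}). 1 + monom 1 (2 * N k div ?g k))"
    by (simp add: case_prod_beta)
  also have "\<dots> = (\<Prod>k = 1..m - 1. (1 + monom 1 (2 * N k div ?g k)) ^ ?g k)"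
    by (subst prod.Sigma[symmetric]) auto
  \<comment> \<open>Since \<open>N k\<close> divides \<open>N 0\<close>, the factors of the higher
    layers depend on \<open>j\<close> only through \<open>gcd j (N 0)\<close>.\<close>
  also have "\<dots> = (\<Prod>k = 1..m - 1. (1 + monom 1 (2 * N k div gcd (gcd j (N 0)) (N k))) ^ gcd (gcd j (N 0)) (N k))"
  proof (rule prod.cong)
    fix k assume "k \<in> {1..m - 1}"
    then have "N k dvd N 0" using m by (subst N_0[of k]) auto
    then have "gcd (gcd j (N 0)) (N k) = gcd j (N k)"
      by (metis gcd.assoc gcd_nat.absorb_iff2 gcd.commute)
    then show "(1 + monom 1 (2 * N k div ?g k)) ^ ?g k =
      (1 + monom (1::real) (2 * N k div gcd (gcd j (N 0)) (N k))) ^ gcd (gcd j (N 0)) (N k)" by simp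
  qed simp
  finally show ?thesis by (simp add: fixed_gf_def)
qed

end

subsection \<open>The additive group of residues\<close>

lemma Zn_simps:
  "carrier (Zn n) = {0..int n - 1}" "x \<otimes>\<^bsub>Zn n\<^esub> y = (x + y) mod int n" "\<one>\<^bsub>Zn n\<^esub> = 0"
  by (simp_all add: Zn_def residue_ring_def)

lemma group_Zn: "n > 1 \<Longrightarrow> group (Zn n)"
  unfolding Zn_def
  by (intro abelian_group.a_group residues.abelian_group) (simp add: residues_def)

lemma inv_Zn:
  assumes "n > 1" "x \<in> {1..<int n}"
  shows "inv\<^bsub>Zn n\<^esub> x = int n - x"
  using assms by (intro group.inv_equality[OF group_Zn]) (auto simp: Zn_simps)

section \<open>Generating sets and automorphisms of the cyclic group of order p^m\<close>

context odd_prime_power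
begin

lemma coprime_elt: "coprime (elt 0 i) (int n)"
proof -
  have "coprime (r ^ i mod n) n"
    using n_gt_2 p_gt_2 coprime_r by (subst coprime_mod_left_iff) (auto simp: n_def coprime_commute)
  then show ?thesis by (simp add: elt_def del: of_nat_mod)
qed

lemma multiple_in_generate:
  assumes "x \<in> \<Omega>"
  shows "(int t * x) mod int n \<in> generate (Zn n) \<Omega>"
proof (induction t)
  case 0
  then show ?case using generate.one[of "Zn n" \<Omega>] by (simp add: Zn_simps)
next
  case (Suc t)
  have "x \<otimes>\<^bsub>Zn n\<^esub> ((int t * x) mod int n) \<in> generate (Zn n) \<Omega>"
    by (intro generate.eng generate.incl assms Suc.IH)
  then show ?case by (simp add: Zn_simps algebra_simps mod_simps)
qed

text \<open>Without units, \<open>\<Omega>\<close> lies in the proper subgroup of multiples of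
  \<open>p\<close>, which misses 1; conversely the multiples of a single unit fill the
  group.\<close>

lemma generate_eq_carrier_iff:
  assumes "\<Omega> \<subseteq> {1..<int n}"
  shows "generate (Zn n) \<Omega> = carrier (Zn n) \<longleftrightarrow> (\<exists>i. elt 0 i \<in> \<Omega>)"
proof
  assume gen: "generate (Zn n) \<Omega> = carrier (Zn n)"
  show "\<exists>i. elt 0 i \<in> \<Omega>"
  proof (rule ccontr)
    assume none: "\<nexists>i. elt 0 i \<in> \<Omega>"
    have pn: "int p dvd int n" using m by (simp add: n_def)
    let ?H = "{x \<in> {0..int n - 1}. int p dvd x}"
    interpret group "Zn n" using n_gt_2 by (intro group_Zn) simp
    have "subgroup ?H (Zn n)"
    proof (rule subgroupI)
      fix a assume a: "a \<in> ?H"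
      show "inv\<^bsub>Zn n\<^esub> a \<in> ?H"
      proof (cases "a = 0")
        case True
        then show ?thesis using a inv_one by (simp add: Zn_simps)
      next
        case False
        then show ?thesis using a n_gt_2 pn by (subst inv_Zn) (auto intro: dvd_diff)
      qed
      fix b assume "b \<in> ?H"
      then show "a \<otimes>\<^bsub>Zn n\<^esub> b \<in> ?H"
        using a pn n_gt_2 by (auto simp: Zn_simps dvd_mod_iff zle_diff1_eq)
    qed (use n_gt_2 in \<open>auto simp: Zn_simps intro: exI[of _ 0]\<close>)
    moreover have "\<Omega> \<subseteq> ?H"
    proof
      fix x assume x: "x \<in> \<Omega>"
      then obtain k i where k: "k < m" "x = elt k i" using assms ex_elt by (meson subsetD)
      then have "k > 0" using none x by (cases k) auto
      then show "x \<in> ?H" using k elt_pos[of k i] by (auto simp: p_dvd_elt)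
    qed
    ultimately have "generate (Zn n) \<Omega> \<subseteq> ?H" by (intro generate_subgroup_incl)
    moreover have "1 \<in> carrier (Zn n)" using n_gt_2 by (simp add: Zn_simps)
    ultimately have "int p dvd 1" using gen by blast
    then show False using p_gt_2 by simp
  qed
next
  assume "\<exists>i. elt 0 i \<in> \<Omega>"
  then obtain i where i: "elt 0 i \<in> \<Omega>" ..
  interpret group "Zn n" using n_gt_2 by (intro group_Zn) simp
  obtain v where v: "[elt 0 i * v = 1] (mod int n)"
    using cong_solve_coprime_int[OF coprime_elt] by blast
  have "x \<in> generate (Zn n) \<Omega>" if "x \<in> carrier (Zn n)" for x
  proof -
    have x: "0 \<le> x" "x < int n" using that by (auto simp: Zn_simps)
    \<comment> \<open>With \<open>v\<close> inverse to the unit, x is the multiple of the unit by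
      \<open>v * x\<close>, taken as a natural number.\<close>
    define t where "t = nat ((v * x) mod int n)"
    have "[int t * elt 0 i = (elt 0 i * v) * x] (mod int n)"
      using n_gt_2 by (simp add: t_def cong_def mod_simps mult_ac)
    also have "[(elt 0 i * v) * x = 1 * x] (mod int n)"
      using v by (intro cong_mult) auto
    finally have "(int t * elt 0 i) mod int n = x"
      using x by (simp add: cong_def)
    then show ?thesis using multiple_in_generate[OF i, of t] by simp
  qed
  moreover have "\<Omega> \<subseteq> carrier (Zn n)" using assms by (auto simp: Zn_simps)
  then have "generate (Zn n) \<Omega> \<subseteq> carrier (Zn n)" by (rule generate_incl)
  ultimately show "generate (Zn n) \<Omega> = carrier (Zn n)" by blast
qed

lemma cayley_sets_Zn: "cayley_sets (Zn n) = conn_sets"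
proof (rule Set.set_eqI)
  fix \<Omega> :: "int set"
  have "\<Omega> \<in> cayley_sets (Zn n) \<longleftrightarrow> \<Omega> \<subseteq> {1..<int n} \<and> (\<lambda>x. inv\<^bsub>Zn n\<^esub> x) ` \<Omega> = \<Omega> \<and>
      generate (Zn n) \<Omega> = carrier (Zn n)"
  proof -
    have "\<Omega> \<subseteq> {0..int n - 1} \<and> 0 \<notin> \<Omega> \<longleftrightarrow> \<Omega> \<subseteq> {1..<int n}"
    proof
      assume *: "\<Omega> \<subseteq> {0..int n - 1} \<and> 0 \<notin> \<Omega>"
      show "\<Omega> \<subseteq> {1..<int n}"
      proof
        fix x assume "x \<in> \<Omega>"
        then have "0 \<le> x" "x < int n" "x \<noteq> 0" using * by auto
        then show "x \<in> {1..<int n}" by simp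
      qed
    qed auto
    then show ?thesis by (auto simp: cayley_sets_def Zn_simps)
  qed
  also have "\<dots> \<longleftrightarrow> \<Omega> \<in> conn_sets"
  proof (cases "\<Omega> \<subseteq> {1..<int n}")
    case True
    then have "(\<lambda>x. inv\<^bsub>Zn n\<^esub> x) ` \<Omega> = (\<lambda>x. int n - x) ` \<Omega>"
      using n_gt_2 by (intro image_cong) (auto simp: inv_Zn)
    \<comment> \<open>The map is an involution, so mapping \<open>\<Omega>\<close> into itself
      already means mapping it onto itself.\<close>
    moreover have "(\<lambda>x. int n - x) ` \<Omega> = \<Omega> \<longleftrightarrow> (\<forall>x\<in>\<Omega>. int n - x \<in> \<Omega>)"
    proof
      assume *: "\<forall>x\<in>\<Omega>. int n - x \<in> \<Omega>"
      show "(\<lambda>x. int n - x) ` \<Omega> = \<Omega>"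
      proof (intro equalityI subsetI)
        fix x assume "x \<in> \<Omega>"
        then show "x \<in> (\<lambda>x. int n - x) ` \<Omega>"
          using * by (intro image_eqI[where x = "int n - x"]) auto
      qed (use * in auto)
    qed blast
    ultimately show ?thesis
      using True by (simp add: conn_sets_def generate_eq_carrier_iff)
  qed (simp add: conn_sets_def)
  finally show "\<Omega> \<in> cayley_sets (Zn n) \<longleftrightarrow> \<Omega> \<in> conn_sets" .
qed

text \<open>An automorphism is multiplication by its value at 1. Surjectivity makes this value a
  unit, hence an element of layer 0, that is, a power of \<open>r\<close>.\<close>

lemma iso_Zn:
  assumes "\<alpha> \<in> iso (Zn n) (Zn n)"
  shows "\<exists>j. \<forall>x\<in>carrier (Zn n). \<alpha> x = int r ^ j * x mod int n"
proof -
  interpret group "Zn n" using n_gt_2 by (intro group_Zn) simp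
  have hom: "\<alpha> \<in> hom (Zn n) (Zn n)" and bij: "\<alpha> ` carrier (Zn n) = carrier (Zn n)"
    using assms by (auto simp: iso_def bij_betw_def)
  have one: "1 \<in> carrier (Zn n)" using n_gt_2 by (simp add: Zn_simps)
  have \<alpha>: "\<alpha> (int t mod int n) = (int t * \<alpha> 1) mod int n" for t
  proof (induction t)
    case 0
    then show ?case using hom_one[OF hom is_group is_group] by (simp add: Zn_simps)
  next
    case (Suc t)
    have "int t mod int n \<in> carrier (Zn n)" using n_gt_2 by (auto simp: Zn_simps)
    then have "\<alpha> (1 \<otimes>\<^bsub>Zn n\<^esub> (int t mod int n)) = \<alpha> 1 \<otimes>\<^bsub>Zn n\<^esub> \<alpha> (int t mod int n)"
      by (rule hom_mult[OF hom one])
    then show ?case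
      by (simp add: Zn_simps Suc.IH mod_simps algebra_simps)
  qed
  have \<alpha>': "\<alpha> x = (x * \<alpha> 1) mod int n" if "x \<in> carrier (Zn n)" for x
    using \<alpha>[of "nat x"] that by (simp add: Zn_simps)
  \<comment> \<open>A preimage of 1 is an inverse of \<open>\<alpha> 1\<close> modulo
    \<open>n\<close>.\<close>
  obtain x where "x \<in> carrier (Zn n)" "\<alpha> x = 1" using bij one by (metis imageE)
  then have "[x * \<alpha> 1 = 1] (mod int n)" using \<alpha>'[of x] n_gt_2 by (simp add: cong_def)
  then have cop: "coprime (\<alpha> 1) (int n)"
    by (metis cong_imp_coprime cong_sym coprime_1_left coprime_mult_left_iff)
  then have "\<alpha> 1 \<noteq> 0" using n_gt_2 by (intro notI) simp
  moreover have "\<alpha> 1 \<in> carrier (Zn n)" using hom one by (auto simp: hom_def)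
  ultimately have "\<alpha> 1 \<in> {1..<int n}" by (auto simp: Zn_simps)
  then obtain k i where ki: "k < m" "\<alpha> 1 = elt k i" using ex_elt by blast
  have "k = 0"
  proof (rule ccontr)
    assume "k \<noteq> 0"
    then have "int p dvd \<alpha> 1" using ki by (simp add: p_dvd_elt)
    moreover have "int p dvd int n" using m by (simp add: n_def)
    ultimately have "is_unit (int p)" using cop by (rule coprime_common_divisor[rotated])
    then show False using p_gt_2 by simp
  qed
  then have "\<alpha> 1 = int r ^ i mod int n" using ki by (simp add: elt_def of_nat_mod)
  then have "\<forall>x\<in>carrier (Zn n). \<alpha> x = int r ^ i * x mod int n"
    using \<alpha>' by (simp add: mod_simps mult.commute)
  then show ?thesis ..
qed

lemma mult_iso_Zn: "(\<lambda>x. int r ^ j * x mod int n) \<in> iso (Zn n) (Zn n)"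
  unfolding iso_def
proof (intro CollectI conjI homI)
  have inj: "inj_on (\<lambda>x. int r ^ j * x mod int n) (carrier (Zn n))"
    using inj_on_mult_r[of j] by (rule inj_on_subset) (auto simp: Zn_simps)
  moreover have sub: "(\<lambda>x. int r ^ j * x mod int n) ` carrier (Zn n) \<subseteq> carrier (Zn n)"
    using n_gt_2 by (auto simp: Zn_simps)
  ultimately show "bij_betw (\<lambda>x. int r ^ j * x mod int n) (carrier (Zn n)) (carrier (Zn n))"
    unfolding bij_betw_def by (simp add: endo_inj_surj Zn_simps(1))
  show "int r ^ j * x mod int n \<in> carrier (Zn n)" if "x \<in> carrier (Zn n)" for x
    using sub that by blast
qed (simp add: Zn_simps mod_simps distrib_left)

lemma iso_image_iff:
  assumes "\<Omega> \<in> conn_sets"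
  shows "(\<exists>\<alpha>\<in>iso (Zn n) (Zn n). \<alpha> ` \<Omega> = \<Omega>') \<longleftrightarrow> (\<exists>j. \<Omega>' = (rot ^^ j) \<Omega>)"
proof -
  have sub: "\<Omega> \<subseteq> {1..<int n}" using assms by (simp add: conn_sets_def)
  show ?thesis
  proof safe
    fix \<alpha> assume "\<alpha> \<in> iso (Zn n) (Zn n)"
    then obtain j where "\<forall>x\<in>carrier (Zn n). \<alpha> x = int r ^ j * x mod int n"
      using iso_Zn by blast
    then have "\<alpha> ` \<Omega> = (rot ^^ j) \<Omega>"
      unfolding rot_funpow_image[OF sub] using sub by (intro image_cong) (auto simp: Zn_simps)
    then show "\<exists>j. \<alpha> ` \<Omega> = (rot ^^ j) \<Omega>" ..
  next
    fix j
    show "\<exists>\<alpha>\<in>iso (Zn n) (Zn n). \<alpha> ` \<Omega> = (rot ^^ j) \<Omega>"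
      using mult_iso_Zn[of j] rot_funpow_image[OF sub, of j] by metis
  qed
qed

section \<open>Burnside count of the weak equivalence classes\<close>

lemma N_mult_aw:
  "N 0 * aw (Zn n) k = (\<Sum>j\<in>{0<..N 0}. card {\<Omega> \<in> conn_sets. (rot ^^ j) \<Omega> = \<Omega> \<and> card \<Omega> = k})"
proof -
  let ?E = "{\<Omega> \<in> conn_sets. card \<Omega> = k}"
  \<comment> \<open>Automorphisms act on connection sets exactly as the powers of
    \<open>rot\<close>, so weak equivalence in degree \<open>k\<close> is the orbit relation of
    \<open>rot\<close> on \<open>?E\<close>.\<close>
  have "{(\<Omega>, \<Omega>'). \<Omega> \<in> conn_sets \<and> card \<Omega> = k \<and> \<Omega>' \<in> conn_sets \<and> card \<Omega>' = k
         \<and> (\<exists>\<alpha> \<in> iso (Zn n) (Zn n). \<alpha> ` \<Omega> = \<Omega>')} =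
       {(\<Omega>, \<Omega>'). \<Omega> \<in> ?E \<and> \<Omega>' \<in> ?E \<and> (\<exists>j. \<Omega>' = (rot ^^ j) \<Omega>)}"
    by (simp add: iso_image_iff conj_assoc cong: conj_cong)
  then have "aw (Zn n) k = card (?E // {(\<Omega>, \<Omega>'). \<Omega> \<in> ?E \<and> \<Omega>' \<in> ?E \<and> (\<exists>j. \<Omega>' = (rot ^^ j) \<Omega>)})"
    unfolding aw_def cayley_sets_Zn by simp
  moreover have "N 0 * card (?E // {(\<Omega>, \<Omega>'). \<Omega> \<in> ?E \<and> \<Omega>' \<in> ?E \<and> (\<exists>j. \<Omega>' = (rot ^^ j) \<Omega>)}) =
    (\<Sum>j\<in>{0<..N 0}. card {\<Omega> \<in> ?E. (rot ^^ j) \<Omega> = \<Omega>})"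
  proof (rule burnside_funpow)
    show "rot \<in> ?E \<rightarrow> ?E"
      using rot_conn_sets card_rot_funpow[of _ 1] by (auto simp: conn_sets_def)
  qed (use m N_pos rot_funpow_N in auto)
  moreover have "{\<Omega> \<in> ?E. (rot ^^ j) \<Omega> = \<Omega>} = {\<Omega> \<in> conn_sets. (rot ^^ j) \<Omega> = \<Omega> \<and> card \<Omega> = k}" for j
    by auto
  ultimately show ?thesis by simp
qed

lemma card_conn_set_bounds:
  assumes "\<Omega> \<in> conn_sets"
  shows "card \<Omega> \<in> {1..n - 1}"
proof -
  have sub: "\<Omega> \<subseteq> {1..<int n}" and ne: "\<Omega> \<noteq> {}" using assms by (auto simp: conn_sets_def)
  have "card \<Omega> \<le> card {1..<int n}" using sub by (intro card_mono) auto
  moreover have "card \<Omega> > 0" using ne conn_set_finite[OF assms] by (simp add: card_gt_0_iff)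
  ultimately show ?thesis by simp
qed

text \<open>Exchanging the sums over degrees and over \<open>j\<close> collects, for each
  \<open>j\<close>, all sets fixed by \<open>r ^ j\<close>; none is lost because cardinalities lie
  in 1..n-1. Grouping the \<open>j\<close> by their gcd with \<open>N 0\<close> gives the divisor
  sum.\<close>

lemma N_smult_Psi_w:
  "smult (real (N 0)) (Psi_w (Zn n)) = (\<Sum>d | d dvd N 0. smult (real (totient (N 0 div d))) (fixed_gf d))"
proof -
  let ?fix = "\<lambda>j. {\<Omega> \<in> conn_sets. (rot ^^ j) \<Omega> = \<Omega>}"
  have "smult (real (N 0)) (Psi_w (Zn n)) = (\<Sum>k = 1..n - 1. monom (real (N 0 * aw (Zn n) k)) k)"
    by (simp add: Psi_w_def Zn_simps smult_sum_right smult_monom)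
  also have "\<dots> = (\<Sum>k = 1..n - 1. \<Sum>j\<in>{0<..N 0}. \<Sum>\<Omega> | \<Omega> \<in> ?fix j \<and> card \<Omega> = k. monom 1 (card \<Omega>))"
  proof (rule sum.cong)
    fix k
    have "monom (real (N 0 * aw (Zn n) k)) k =
      (\<Sum>j\<in>{0<..N 0}. monom (real (card {\<Omega> \<in> conn_sets. (rot ^^ j) \<Omega> = \<Omega> \<and> card \<Omega> = k})) k)"
      unfolding N_mult_aw of_nat_sum by (rule poly_eqI) (simp add: coeff_sum)
    also have "\<dots> = (\<Sum>j\<in>{0<..N 0}. \<Sum>\<Omega> | \<Omega> \<in> ?fix j \<and> card \<Omega> = k. monom 1 (card \<Omega>))"
      by (intro sum.cong) (auto simp: of_nat_poly smult_monom conj_assoc)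
    finally show "monom (real (N 0 * aw (Zn n) k)) k = \<dots>" .
  qed simp
  also have "\<dots> = (\<Sum>j\<in>{0<..N 0}. \<Sum>k = 1..n - 1. \<Sum>\<Omega> | \<Omega> \<in> ?fix j \<and> card \<Omega> = k. monom 1 (card \<Omega>))"
    by (rule sum.swap)
  also have "\<dots> = (\<Sum>j\<in>{0<..N 0}. \<Sum>\<Omega>\<in>?fix j. monom 1 (card \<Omega>))"
    using card_conn_set_bounds by (intro sum.cong refl sum.group) auto
  also have "\<dots> = (\<Sum>j\<in>{0<..N 0}. fixed_gf (gcd j (N 0)))"
    by (intro sum.cong) (auto simp: sum_fixed)
  also have "\<dots> = (\<Sum>d | d dvd N 0. smult (real (totient (N 0 div d))) (fixed_gf d))"
    using m N_pos[of 0] by (subst sum_gcd_eq_sum_divisors) (auto simp: of_nat_poly)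
  finally show ?thesis .
qed

end

section \<open>The closed formula and its value at 1\<close>

theorem theorem4p3:
  fixes p m :: nat
  assumes "Factorial_Ring.prime p" and "odd p" and "m \<ge> 1"
  defines "g \<equiv> (\<lambda>k d. gcd d (totient (p ^ (m - k)) div 2))"
  shows "Psi_w (Zn (p ^ m)) =
      smult (2 / (real (p ^ (m - 1)) * (real p - 1)))
        (\<Sum>d \<in> {d. d dvd totient (p ^ m) div 2}.
           smult (real (totient (totient (p ^ m) div (2 * d))))
             ((([:1:] + monom 1 (totient (p ^ m) div d)) ^ d - 1) *
              (\<Prod>k = 1..m - 1. ([:1:] + monom 1 (totient (p ^ (m - k)) div g k d)) ^ g k d)))
    \<and> real (E_w (Zn (p ^ m))) = poly (Psi_w (Zn (p ^ m))) 1
    \<and> real (E_w (Zn (p ^ m))) =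
      2 / (real (p ^ (m - 1)) * (real p - 1)) *
        (\<Sum>d \<in> {d. d dvd totient (p ^ m) div 2}.
           real (totient (totient (p ^ m) div (2 * d))) * (2 ^ d - 1) *
           (\<Prod>k = 1..m - 1. 2 ^ g k d))"
proof -
  obtain r where "\<forall>k>0. residue_primroot (p ^ k) r"
    using residue_primroot_odd_prime_power_exists assms(1,2) by blast
  then interpret odd_prime_power p m r
    using assms by unfold_locales auto
  have N0: "totient (p ^ m) div 2 = N 0" by (simp add: N_def)
  have N0_pos: "N 0 > 0" using N_pos[of 0] m by simp
  have tot: "totient (p ^ m) = 2 * N 0" using totient_layer[of 0] m by simp
  \<comment> \<open>The denominator of the prefactor is the totient of \<open>p ^ m\<close>, so the
    prefactor is the Burnside factor \<open>1 / N 0\<close>.\<close>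
  have "real (totient (p ^ m)) = real (p ^ (m - 1)) * (real p - 1)"
    using m p_gt_2 p by (simp add: totient_prime_power of_nat_diff)
  then have "real (p ^ (m - 1)) * (real p - 1) = 2 * real (N 0)"
    by (simp add: tot)
  then have scale: "2 / (real (p ^ (m - 1)) * (real p - 1)) = 1 / real (N 0)"
    by simp
  have fixed_gf: "fixed_gf d = (([:1:] + monom 1 (totient (p ^ m) div d)) ^ d - 1) *
      (\<Prod>k = 1..m - 1. ([:1:] + monom 1 (totient (p ^ (m - k)) div g k d)) ^ g k d)" for d
  proof -
    have "(\<Prod>k = 1..m - 1. (1 + monom (1::real) (2 * N k div gcd d (N k))) ^ gcd d (N k)) =
      (\<Prod>k = 1..m - 1. ([:1:] + monom 1 (totient (p ^ (m - k)) div g k d)) ^ g k d)"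
    proof (rule prod.cong)
      fix k assume "k \<in> {1..m - 1}"
      then have "totient (p ^ (m - k)) = 2 * N k" using m by (intro totient_layer) auto
      then show "(1 + monom (1::real) (2 * N k div gcd d (N k))) ^ gcd d (N k) =
        ([:1:] + monom 1 (totient (p ^ (m - k)) div g k d)) ^ g k d"
        by (simp add: g_def one_pCons)
    qed simp
    then show ?thesis by (simp add: fixed_gf_def tot one_pCons)
  qed
  have "Psi_w (Zn (p ^ m)) = smult (1 / real (N 0)) (smult (real (N 0)) (Psi_w (Zn n)))"
    using N0_pos by (simp add: n_def)
  also have "\<dots> = smult (2 / (real (p ^ (m - 1)) * (real p - 1)))
        (\<Sum>d \<in> {d. d dvd totient (p ^ m) div 2}.
           smult (real (totient (totient (p ^ m) div (2 * d))))
             ((([:1:] + monom 1 (totient (p ^ m) div d)) ^ d - 1) *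
              (\<Prod>k = 1..m - 1. ([:1:] + monom 1 (totient (p ^ (m - k)) div g k d)) ^ g k d)))"
    unfolding N_smult_Psi_w scale N0 fixed_gf div_mult2_eq ..
  finally have Psi: "Psi_w (Zn (p ^ m)) = \<dots>" .
  have E: "real (E_w (Zn (p ^ m))) = poly (Psi_w (Zn (p ^ m))) 1"
    by (simp add: E_w_def Psi_w_def poly_sum poly_monom)
  also have "\<dots> = 2 / (real (p ^ (m - 1)) * (real p - 1)) *
        (\<Sum>d \<in> {d. d dvd totient (p ^ m) div 2}.
           real (totient (totient (p ^ m) div (2 * d))) * (2 ^ d - 1) *
           (\<Prod>k = 1..m - 1. 2 ^ g k d))"
    \<comment> \<open>At 1 every monomial becomes 1, so each factor \<open>1 + monom 1 e\<close>
      becomes 2.\<close>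
    unfolding Psi by (simp add: poly_sum poly_prod poly_monom mult.assoc)
  finally show ?thesis using Psi E by blast
qed

end
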